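(* Let $\delta\ge1$ be an integer and $n\ge0$. For any vertex with degree $k$ in the weighted graph $\mathcal{W}_n$, its weighted clustering coefficient is $\frac{1}{k-1}$, independent of its strength.
   Context: The weighted clustering coefficient of a vertex $v$ with degree $k_v$ and strength $s_v$ is $$C_v^w=\frac{1}{s_v(k_v-1)}\sum_{j,h}\frac{w_{vj}+w_{vh}}{2}a_{vj}a_{vh}a_{jh},$$ where the sum is over all ordered pairs $(j,h)$ of vertices, $w_{xy}$ is the weight of edge $xy$, and $a_{xy}=1$ if $x,y$ are adjacent and $a_{xy}=0$ otherwise. The strength of a vertex $i$ in a weighted graph is $s_i=\sum_j w_{ij}$, the sum of the weights of its incident edges; the degree is the number of neighbors. The weighted graphs $\mathcal{W}_n$ ($n\ge 0$) are defined recursively for a fixed integer $\delta\ge1$. $\mathcal{W}_0$ is a triangle whose three edges have weight $1$. For $n\ge1$, $\mathcal{W}_n$ is obtained from $\mathcal{W}_{n-1}$ as follows: (I) for each vertex $i$ of $\mathcal{W}_{n-1}$, of strength $s_i$ in $\mathcal{W}_{n-1}$ (always an even integer), take $s_i/2$ new disjoint copies of $\mathcal{K}_2$ (two vertices joined by an edge of weight $1$) and join both vertices of each copy to $i$ by edges of weight $1$; (II) multiply the weight of every edge that already belonged to $\mathcal{W}_{n-1}$ by $1+\delta$. *)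

theory Defs
  imports Complex_Main
begin

text \<open>
  Edges are unordered pairs, so adjacency and weights are symmetric by construction.
  The field \<open>wt\<close> is meaningful on edges only.
\<close>

record 'a wgraph =
  verts :: "'a set"
  edges :: "'a set set"
  wt :: "'a set \<Rightarrow> nat"

definition adj :: "'a wgraph \<Rightarrow> 'a \<Rightarrow> 'a \<Rightarrow> bool" where
  "adj G x y \<longleftrightarrow> {x, y} \<in> edges G"

definition weight :: "'a wgraph \<Rightarrow> 'a \<Rightarrow> 'a \<Rightarrow> nat" where
  "weight G x y = (if adj G x y then wt G {x, y} else 0)"

definition degree :: "'a wgraph \<Rightarrow> 'a \<Rightarrow> nat" where
  "degree G v = card {u \<in> verts G. adj G v u}"

definition strength :: "'a wgraph \<Rightarrow> 'a \<Rightarrow> nat" where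
  "strength G v = (\<Sum>u\<in>verts G. weight G v u)"

definition weighted_clustering :: "'a wgraph \<Rightarrow> 'a \<Rightarrow> real" where
  "weighted_clustering G v =
     1 / (real (strength G v) * (real (degree G v) - 1)) *
     (\<Sum>(j, h)\<in>verts G \<times> verts G.
        (real (weight G v j) + real (weight G v h)) / 2 *
        of_bool (adj G v j) * of_bool (adj G v h) * of_bool (adj G j h))"

text \<open>
  \<open>New t i c b\<close> is the endpoint \<open>b\<close> of the \<open>c\<close>-th copy of the complete graph on two
  vertices that is attached to the vertex \<open>i\<close> in step \<open>t\<close>. The step number keeps the
  vertices created in different steps distinct.
\<close>

datatype vertex = Corner nat | New nat vertex nat bool

definition triangle :: "vertex wgraph" where
  "triangle =
     \<lparr> verts = {Corner 0, Corner 1, Corner 2},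
       edges = {{Corner 0, Corner 1}, {Corner 1, Corner 2}, {Corner 0, Corner 2}},
       wt = (\<lambda>_. 1) \<rparr>"

text \<open>
  Index set of the attached copies. In the graphs \<open>W \<delta> n\<close> below all strengths are even
  (\<open>even_strength_W\<close>), so \<open>div\<close> does not round.
\<close>

definition copies :: "'a wgraph \<Rightarrow> ('a \<times> nat) set" where
  "copies G = (SIGMA i:verts G. {..<strength G i div 2})"

definition grow :: "nat \<Rightarrow> nat \<Rightarrow> vertex wgraph \<Rightarrow> vertex wgraph" where
  "grow \<delta> t G =
     \<lparr> verts = verts G \<union> {New t i c b | i c b. (i, c) \<in> copies G},
       edges = edges G
         \<union> {{New t i c False, New t i c True} | i c. (i, c) \<in> copies G}
         \<union> {{i, New t i c b} | i c b. (i, c) \<in> copies G},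
       wt = (\<lambda>e. if e \<in> edges G then (1 + \<delta>) * wt G e else 1) \<rparr>"

primrec W :: "nat \<Rightarrow> nat \<Rightarrow> vertex wgraph" where
  "W \<delta> 0 = triangle"
| "W \<delta> (Suc n) = grow \<delta> (Suc n) (W \<delta> n)"

definition W_inv :: "nat \<Rightarrow> vertex wgraph \<Rightarrow> bool" where
  "W_inv n G \<longleftrightarrow> finite (verts G) \<and> (\<forall>e\<in>edges G. e \<subseteq> verts G) \<and>
     (\<forall>t i c b. New t i c b \<in> verts G \<longrightarrow> t \<le> n) \<and> (\<forall>v\<in>verts G. even (strength G v))"

lemma W_inv_triangle: "W_inv 0 triangle"
  by (auto simp: W_inv_def triangle_def strength_def weight_def adj_def doubleton_eq_iff)

lemma W_inv_grow:
  assumes "W_inv n G" shows "W_inv (Suc n) (grow \<delta> (Suc n) G)"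
proof -
  define t where "t = Suc n"
  define H where "H = grow \<delta> t G"
  have fin: "finite (verts G)" and sub: "\<And>e. e \<in> edges G \<Longrightarrow> e \<subseteq> verts G"
    and old: "\<And>i c b. New t i c b \<notin> verts G" 
    and old': "\<And>t i c b. New t i c b \<in> verts G \<Longrightarrow> t \<le> n"
    using assms by (force simp: W_inv_def t_def)+
  have ev: "\<And>v. v \<in> verts G \<Longrightarrow> even (strength G v)" using assms by (auto simp: W_inv_def)
  define f where "f = (\<lambda>(p, b). New t (fst p) (snd p) b)"
  have finc: "finite (copies G)" using fin by (auto simp: copies_def)
  have inj: "inj_on f (copies G \<times> UNIV)" by (auto simp: inj_on_def f_def)
  have N: "{New t i c b | i c b. (i, c) \<in> copies G} = f ` (copies G \<times> UNIV)"
    by (force simp: f_def image_iff)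
  have cV: "\<And>i c. (i, c) \<in> copies G \<Longrightarrow> i \<in> verts G" by (auto simp: copies_def)
  have vH: "verts H = verts G \<union> f ` (copies G \<times> UNIV)" by (simp only: H_def grow_def wgraph.simps N)
  have finH: "finite (verts H)" using fin finc by (simp add: vH)
  have disj: "verts G \<inter> f ` (copies G \<times> UNIV) = {}" using old by (auto simp: f_def)
  have S: "strength H v = (\<Sum>u\<in>verts G. weight H v u) + (\<Sum>p\<in>copies G. \<Sum>b\<in>UNIV. weight H v (f (p, b)))" for v
    unfolding strength_def vH
    by (subst sum.union_disjoint) (use fin finc disj inj in \<open>auto simp: sum.reindex sum.cartesian_product\<close>)
  have eH: "edges H = edges G
         \<union> {{New t i c False, New t i c True} | i c. (i, c) \<in> copies G}
         \<union> {{i, New t i c b} | i c b. (i, c) \<in> copies G}" by (simp add: H_def grow_def)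
  have wH: "wt H e = (if e \<in> edges G then (1 + \<delta>) * wt G e else 1)" for e by (simp add: H_def grow_def)
  have oo: "weight H v u = (1+\<delta>) * weight G v u" if "v \<in> verts G" "u \<in> verts G" for u v
  proof -
    have "{v,u} \<in> edges H \<longleftrightarrow> {v,u} \<in> edges G"
      using that old by (auto simp: eH doubleton_eq_iff)
    then show ?thesis by (simp add: weight_def adj_def wH)
  qed
  have nE: "{x, New t i c b} \<notin> edges G" for x i c b using sub old by blast
  have on: "weight H v (f ((i,c), b)) = of_bool (i = v)" if "v \<in> verts G" "(i, c) \<in> copies G" for v i c b
    using that old nE by (auto simp: weight_def adj_def wH f_def eH doubleton_eq_iff)
  have nn: "strength H (New t i c b) = 2" if ic: "(i, c) \<in> copies G" for i c b
  proof -
    have "weight H (New t i c b) u = of_bool (u \<in> {i, New t i c (\<not> b)})" if "u \<in> verts H" for u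
    proof -
      have "{New t i c b, u} \<notin> edges G" using nE[of u i c b] by (simp add: insert_commute)
      moreover have "{New t i c b, u} \<in> edges H \<longleftrightarrow> u \<in> {i, New t i c (\<not> b)}"
      proof
        have "(New t i' c' b', d) \<notin> copies G" for i' c' b' d using cV old by blast
        then show "u \<in> {i, New t i c (\<not> b)}" if "{New t i c b, u} \<in> edges H"
          using that calculation by (auto simp: eH doubleton_eq_iff)
        have "{New t i c b, i} \<in> edges H" using ic unfolding eH by blast
        moreover have "{New t i c b, New t i c (\<not> b)} = {New t i c False, New t i c True}"
          by (cases b) auto
        then have "{New t i c b, New t i c (\<not> b)} \<in> edges H" using ic unfolding eH by blast
        ultimately show "{New t i c b, u} \<in> edges H" if "u \<in> {i, New t i c (\<not> b)}"
          using that by blast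
      qed
      ultimately show ?thesis by (simp add: weight_def adj_def wH)
    qed
    then have "strength H (New t i c b) = (\<Sum>u\<in>verts H. of_bool (u \<in> {i, New t i c (\<not> b)}))"
      unfolding strength_def by (intro sum.cong) auto
    also have "\<dots> = card (verts H \<inter> {i, New t i c (\<not> b)})"
      using finH by (simp add: of_bool_def sum.If_cases Int_def)
    also have "verts H \<inter> {i, New t i c (\<not> b)} = {i, New t i c (\<not> b)}"
      using ic cV by (force simp: vH f_def image_iff)
    also have "card {i, New t i c (\<not> b)} = 2" using cV[OF ic] old by (auto simp: card_insert_if)
    finally show ?thesis .
  qed
  have "even (strength H v)" if "v \<in> verts H" for v
  proof (cases "v \<in> verts G")
    case True
    have "(\<Sum>u\<in>verts G. weight H v u) = (1+\<delta>) * strength G v"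
      unfolding strength_def sum_distrib_left using True oo by (intro sum.cong) auto
    moreover have "(\<Sum>p\<in>copies G. \<Sum>b\<in>UNIV. weight H v (f (p, b))) = (\<Sum>p\<in>copies G. 2 * of_bool (fst p = v))"
      using True on by (intro sum.cong) (auto simp: UNIV_bool)
    ultimately show ?thesis using ev[OF True] by (simp add: S sum_distrib_left[symmetric])
  next
    case False
    then show ?thesis using that nn by (auto simp: vH f_def)
  qed
  moreover have "\<forall>e\<in>edges H. e \<subseteq> verts H"
    using sub cV unfolding eH vH by (force simp: f_def image_iff)
  moreover have "\<forall>s i c b. New s i c b \<in> verts H \<longrightarrow> s \<le> Suc n"
    using old' by (force simp: vH f_def t_def)
  ultimately have "W_inv (Suc n) H" using finH by (simp add: W_inv_def)
  then show ?thesis by (simp add: H_def t_def)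
qed

lemma W_inv_W: "W_inv n (W \<delta> n)"
  by (induction n) (simp_all add: W_inv_triangle W_inv_grow)

lemma even_strength_W: "v \<in> verts (W \<delta> n) \<Longrightarrow> even (strength (W \<delta> n) v)"
  using W_inv_W by (auto simp: W_inv_def)

end

theory Submission imports Defs
begin

text \<open>
  Every edge of \<open>W \<delta> n\<close> lies in exactly one triangle: a new vertex has only two neighbours,
  which are adjacent, so a growth step closes no further triangle on an old edge. By symmetry the
  sum in the clustering coefficient of \<open>v\<close> is the sum, over the neighbours \<open>j\<close> of \<open>v\<close>, of the weight
  of the edge \<open>vj\<close> times the number of triangles on it. So it equals the strength of \<open>v\<close>, which
  cancels.
\<close>

lemma adj_commute: "adj G x y \<longleftrightarrow> adj G y x"
  by (simp add: adj_def insert_commute)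

text \<open>Excluding loops strengthens the induction: a loop at \<open>i\<close> would give each
  new edge at \<open>i\<close> a second common neighbour, and distinct ends keep a new vertex from
  being joined to both ends of an old edge.\<close>

definition edges_in_one_triangle :: "'a wgraph \<Rightarrow> bool" where
  "edges_in_one_triangle G \<longleftrightarrow>
     (\<forall>x y. adj G x y \<longrightarrow> x \<noteq> y \<and> (\<exists>!z. adj G x z \<and> adj G y z))"

lemma clustering_sum_eq_strength:
  assumes fin: "finite (verts G)" and sub: "\<forall>e\<in>edges G. e \<subseteq> verts G"
    and tri: "edges_in_one_triangle G"
  shows "(\<Sum>(j, h)\<in>verts G \<times> verts G. (real (weight G v j) + real (weight G v h)) / 2 *
           of_bool (adj G v j) * of_bool (adj G v h) * of_bool (adj G j h)) = real (strength G v)"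
proof -
  \<comment> \<open>One half of the symmetric summand. The factor for adjacency of \<open>v\<close>
    and \<open>j\<close> is absorbed by \<open>weight G v j\<close>, which is 0 off the
    edges.\<close>
  define g :: "'a \<Rightarrow> 'a \<Rightarrow> real" where
    "g j h = weight G v j * of_bool (adj G v h \<and> adj G j h)" for j h
  have row: "(\<Sum>h\<in>verts G. g j h) = weight G v j" for j
  proof (cases "adj G v j")
    case True
    then obtain z where z: "\<And>h. adj G v h \<and> adj G j h \<longleftrightarrow> h = z"
      using tri unfolding edges_in_one_triangle_def by metis
    \<comment> \<open>The apex \<open>z\<close> must lie in the range of summation for the row sum
      to pick it up.\<close>
    then have "{v, z} \<in> edges G" unfolding adj_def by blast
    then have "z \<in> verts G" using sub by blast
    then show ?thesis by (simp add: g_def z sum_distrib_left[symmetric] fin)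
  qed (simp add: g_def weight_def)
  have "(\<Sum>(j, h)\<in>verts G \<times> verts G. (real (weight G v j) + real (weight G v h)) / 2 *
           of_bool (adj G v j) * of_bool (adj G v h) * of_bool (adj G j h))
      = (\<Sum>j\<in>verts G. \<Sum>h\<in>verts G. (g j h + g h j) / 2)"
    unfolding sum.cartesian_product
    by (intro sum.cong) (auto simp: g_def weight_def adj_commute add_divide_distrib)
  also have "\<dots> = ((\<Sum>j\<in>verts G. \<Sum>h\<in>verts G. g j h) + (\<Sum>j\<in>verts G. \<Sum>h\<in>verts G. g h j)) / 2"
    by (simp only: sum.distrib sum_divide_distrib[symmetric])
  also have "(\<Sum>j\<in>verts G. \<Sum>h\<in>verts G. g h j) = (\<Sum>j\<in>verts G. \<Sum>h\<in>verts G. g j h)"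
    by (rule sum.swap)
  finally show ?thesis by (simp add: row strength_def)
qed

lemma edges_in_one_triangle_triangle: "edges_in_one_triangle triangle"
  unfolding edges_in_one_triangle_def triangle_def adj_def
  by (auto simp: doubleton_eq_iff)

context
  fixes n t :: nat and G :: "vertex wgraph"
  assumes inv: "W_inv n G" and t: "n < t"
begin

text \<open>Step labels occurring in \<open>G\<close> are at most \<open>n\<close>, hence below
  \<open>t\<close>.\<close>

lemma New_notin_verts: "New t i c b \<notin> verts G"
  using inv t by (fastforce simp: W_inv_def)

lemma edge_subset_verts: "e \<in> edges G \<Longrightarrow> e \<subseteq> verts G"
  using inv by (auto simp: W_inv_def)

lemma adj_verts: "adj G x y \<Longrightarrow> x \<in> verts G \<and> y \<in> verts G"
  using edge_subset_verts by (auto simp: adj_def)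

lemma copies_verts: "(i, c) \<in> copies G \<Longrightarrow> i \<in> verts G"
  by (simp add: copies_def)

text \<open>Every added edge has an endpoint labelled \<open>t\<close>, which lies outside
  \<open>G\<close>.\<close>

lemma adj_grow_old:
  assumes "x \<in> verts G" "y \<in> verts G"
  shows "adj (grow \<delta> t G) x y \<longleftrightarrow> adj G x y"
  using assms New_notin_verts by (auto simp: adj_def grow_def doubleton_eq_iff)

lemma adj_grow_New:
  assumes ic: "(i, c) \<in> copies G"
  shows "adj (grow \<delta> t G) (New t i c b) u \<longleftrightarrow> u = i \<or> u = New t i c (\<not> b)"
proof
  have "{New t i c b, u} \<notin> edges G"
    using edge_subset_verts New_notin_verts by blast
  \<comment> \<open>Copies are attached to old vertices only, so a new vertex is never the attaching
    end of an added edge.\<close>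
  moreover have "(New t i' c' b', d) \<notin> copies G" for i' c' b' d
    using copies_verts New_notin_verts by blast
  ultimately show "u = i \<or> u = New t i c (\<not> b)" if "adj (grow \<delta> t G) (New t i c b) u"
    using that by (auto simp: adj_def grow_def doubleton_eq_iff)
  show "adj (grow \<delta> t G) (New t i c b) u" if "u = i \<or> u = New t i c (\<not> b)"
    using ic that by (cases b) (auto simp: adj_def grow_def doubleton_eq_iff)
qed

lemma verts_grow_cases:
  assumes "x \<in> verts (grow \<delta> t G)"
  obtains "x \<in> verts G" | i c b where "(i, c) \<in> copies G" "x = New t i c b"
  using assms by (auto simp: grow_def)

lemma adj_grow_verts: "adj (grow \<delta> t G) x y \<Longrightarrow> x \<in> verts (grow \<delta> t G)"
  using edge_subset_verts copies_verts by (auto simp: adj_def grow_def doubleton_eq_iff)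

lemma edges_in_one_triangle_grow:
  assumes tri: "edges_in_one_triangle G"
  shows "edges_in_one_triangle (grow \<delta> t G)"
proof -
  define H where "H = grow \<delta> t G"
  \<comment> \<open>Edges with a new endpoint, listed first: the third vertex is the twin of
    \<open>x\<close> if \<open>y = i\<close>, and \<open>i\<close> if \<open>y\<close> is that
    twin.\<close>
  have new: "x \<noteq> y \<and> (\<exists>!z. adj H x z \<and> adj H y z)"
    if ic: "(i, c) \<in> copies G" and x: "x = New t i c b" and xy: "adj H x y" for x y i c b
  proof -
    have i: "i \<in> verts G" "New t i c d \<noteq> i" "\<not> adj H i i" for d
      using copies_verts[OF ic] New_notin_verts tri
      by (auto simp: H_def adj_grow_old edges_in_one_triangle_def)
    have N: "adj H (New t i c d) u \<longleftrightarrow> u = i \<or> u = New t i c (\<not> d)" for d u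
      unfolding H_def by (rule adj_grow_New[OF ic])
    have N': "adj H u (New t i c d) \<longleftrightarrow> u = i \<or> u = New t i c (\<not> d)" for d u
      using N adj_commute by metis
    consider "y = i" | "y = New t i c (\<not> b)" using xy x N by auto
    then show ?thesis
    proof cases
      case 1
      have "adj H x z \<and> adj H y z \<longleftrightarrow> z = New t i c (\<not> b)" for z
        using i N N' x 1 by auto
      then show ?thesis using i x 1 by auto
    next
      case 2
      have "adj H x z \<and> adj H y z \<longleftrightarrow> z = i" for z
        using N x 2 by auto
      then show ?thesis using x 2 by auto
    qed
  qed
  have "x \<noteq> y \<and> (\<exists>!z. adj H x z \<and> adj H y z)" if xy: "adj H x y" for x y
  proof -
    have yx: "adj H y x" using xy adj_commute by metis
    have "x \<in> verts H" "y \<in> verts H"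
      using xy yx adj_grow_verts unfolding H_def by blast+
    then consider "x \<in> verts G" "y \<in> verts G"
      | i c b where "(i, c) \<in> copies G" "x = New t i c b"
      | i c b where "(i, c) \<in> copies G" "y = New t i c b"
      unfolding H_def by (metis verts_grow_cases)
    then show ?thesis
    proof cases
      case 1
      then have "adj G x y" using xy by (simp add: H_def adj_grow_old)
      then have ne: "x \<noteq> y" and ex: "\<exists>!z. adj G x z \<and> adj G y z"
        using tri by (auto simp: edges_in_one_triangle_def)
      have "adj H x z \<and> adj H y z \<longleftrightarrow> adj G x z \<and> adj G y z" for z
      proof (cases "z \<in> verts G")
        case True
        then show ?thesis using 1 by (simp add: H_def adj_grow_old)
      next
        case False
        \<comment> \<open>A common neighbour outside \<open>G\<close> is a new vertex, whose only
          old neighbour is its attachment point \<open>i\<close>; this forces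
          \<open>x = y\<close>.\<close>
        have "False" if "adj H x z" "adj H y z"
        proof -
          have zx: "adj H z x" and zy: "adj H z y" using that adj_commute by metis+
          then obtain i c b where "(i, c) \<in> copies G" "z = New t i c b"
            using False adj_grow_verts verts_grow_cases unfolding H_def by metis
          then have "x = i" "y = i"
            using zx zy 1 New_notin_verts adj_grow_New unfolding H_def by metis+
          then show False using ne by simp
        qed
        then show ?thesis using adj_verts False by blast
      qed
      then show ?thesis using ne ex by simp
    next
      case 2
      then show ?thesis using new xy by blast
    next
      case 3
      \<comment> \<open>The claim is symmetric in \<open>x\<close> and \<open>y\<close>, so
        \<open>new\<close> applies to the reversed edge.\<close>
      then show ?thesis using new[OF _ _ yx] by (simp add: conj_commute eq_commute)
    qed
  qed
  then show ?thesis by (simp add: edges_in_one_triangle_def H_def)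
qed

end

lemma edges_in_one_triangle_W: "edges_in_one_triangle (W \<delta> n)"
proof (induction n)
  case (Suc n)
  then show ?case using edges_in_one_triangle_grow[OF W_inv_W, of n "Suc n"] by simp
qed (simp add: edges_in_one_triangle_triangle)

text \<open>New edges get weight 1, and old weights are only multiplied by
  \<open>1 + \<delta>\<close>.\<close>

lemma wt_W_pos: "0 < wt (W \<delta> n) e"
  if "e \<in> edges (W \<delta> n)"
  using that by (induction n arbitrary: e) (auto simp: triangle_def grow_def)

lemma not_isolated_W: "v \<in> verts (W \<delta> n) \<Longrightarrow> \<exists>u. adj (W \<delta> n) v u"
proof (induction n)
  case 0
  then show ?case by (auto simp: triangle_def adj_def)
next
  case (Suc n)
  have v: "v \<in> verts (grow \<delta> (Suc n) (W \<delta> n))" using Suc.prems by simp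
  show ?case
    using W_inv_W lessI v
  proof (cases rule: verts_grow_cases)
    case 1
    then show ?thesis using Suc.IH by (auto simp: adj_def grow_def)
  next
    case (2 i c b)
    then show ?thesis using adj_grow_New[OF W_inv_W lessI] by auto
  qed
qed

text \<open>Needed to cancel the strength in the coefficient, since division by 0 yields 0. Some
  incident edge exists, and its positive weight bounds the strength from below.\<close>

lemma strength_W_pos:
  assumes "v \<in> verts (W \<delta> n)"
  shows "0 < strength (W \<delta> n) v"
proof -
  have inv: "finite (verts (W \<delta> n))" "\<forall>e\<in>edges (W \<delta> n). e \<subseteq> verts (W \<delta> n)"
    using W_inv_W[of n \<delta>] by (auto simp: W_inv_def)
  obtain u where u: "adj (W \<delta> n) v u" using not_isolated_W[OF assms] by blast
  then have "0 < weight (W \<delta> n) v u" by (simp add: weight_def adj_def wt_W_pos)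
  also have "weight (W \<delta> n) v u \<le> strength (W \<delta> n) v"
    unfolding strength_def using inv u by (intro member_le_sum) (auto simp: adj_def)
  finally show ?thesis .
qed

theorem proposition3p5:
  fixes \<delta> n k :: nat and v :: vertex
  assumes "\<delta> \<ge> 1"
    and "v \<in> verts (W \<delta> n)"
    and "degree (W \<delta> n) v = k"
  shows "weighted_clustering (W \<delta> n) v = 1 / (real k - 1)"
proof -
  have "finite (verts (W \<delta> n))" "\<forall>e\<in>edges (W \<delta> n). e \<subseteq> verts (W \<delta> n)"
    using W_inv_W[of n \<delta>] by (auto simp: W_inv_def)
  then show ?thesis
    unfolding weighted_clustering_def
    using strength_W_pos[OF assms(2)] assms(3)
    by (subst clustering_sum_eq_strength) (auto simp: edges_in_one_triangle_W)
qed

end
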